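(* Let $\mathcal{T}=(t_{ijkl})$ be a real 4th-order 3-dimensional symmetric tensor with $t_{iiii}>0$ for all $i\in\{1,2,3\}$. Assume that $$t_{1123}\geq-t_{1111}^{1/2}t_{2222}^{1/4}t_{3333}^{1/4},\quad t_{1223}\geq -t_{1111}^{1/4}t_{2222}^{1/2}t_{3333}^{1/4},\quad t_{1233}\geq -t_{1111}^{1/4}t_{2222}^{1/4}t_{3333}^{1/2}.$$ Then $\mathcal{T}$ is strictly copositive if for all $i,j\in\{1,2,3\}$ with $i\ne j$, $$t_{iijj}\geq \sqrt{t_{iiii}t_{jjjj}},\qquad t_{iiij}\geq t_{iiii}^{3/4}t_{jjjj}^{1/4}.$$
   Context: A 4th-order $n$-dimensional tensor $\mathcal{T}=(t_{ijkl})$ is symmetric if its entries are invariant under every permutation of the four indices. Put $\mathcal{T}x^4=\sum_{i,j,k,l=1}^n t_{ijkl}x_ix_jx_kx_l$ for $x\in\mathbb{R}^n$. $\mathcal{T}$ is strictly copositive if $\mathcal{T}x^4>0$ for all $x\in\mathbb{R}^n_+\setminus\{0\}$, where $\mathbb{R}^n_+$ is the nonnegative orthant. *)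

theory Defs
  imports "HOL-Analysis.Analysis"
begin

text \<open>
  A 4th-order tensor of dimension \<open>n = CARD('n)\<close> is given by its entries, indexed by the finite
  type \<open>'n\<close>. For dimension 3 the index type is \<open>3\<close>, whose elements are the distinct \<open>1, 2, 3\<close>
  (arithmetic in it is modulo 3, so \<open>3 = 0\<close> there; see \<open>UNIV_3\<close>).
\<close>

type_synonym 'n tensor4 = "'n \<Rightarrow> 'n \<Rightarrow> 'n \<Rightarrow> 'n \<Rightarrow> real"

text \<open>
  A multi-index is given by \<open>s 1, s 2, s 3, s 4\<close>; a permutation \<open>p\<close> of the four
  positions acts by \<open>s \<circ> p\<close>.
\<close>

definition symmetric_tensor4 :: "'n tensor4 \<Rightarrow> bool" where
  "symmetric_tensor4 T \<longleftrightarrow>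
    (\<forall>(s :: nat \<Rightarrow> 'n) p. p permutes {1..4} \<longrightarrow>
      T (s (p 1)) (s (p 2)) (s (p 3)) (s (p 4)) = T (s 1) (s 2) (s 3) (s 4))"

definition tensor4_form :: "'n::finite tensor4 \<Rightarrow> real ^ 'n \<Rightarrow> real" where
  "tensor4_form T x =
    (\<Sum>i\<in>UNIV. \<Sum>j\<in>UNIV. \<Sum>k\<in>UNIV. \<Sum>l\<in>UNIV. T i j k l * x $ i * x $ j * x $ k * x $ l)"

definition strictly_copositive :: "'n::finite tensor4 \<Rightarrow> bool" where
  "strictly_copositive T \<longleftrightarrow>
    (\<forall>x :: real ^ 'n. (\<forall>i. 0 \<le> x $ i) \<and> x \<noteq> 0 \<longrightarrow> 0 < tensor4_form T x)"

end

theory Submission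
  imports Defs
begin

text \<open>
  Put \<open>a i = T i i i i powr (1/4)\<close> and substitute \<open>u i = a i * x $ i\<close>. Then, in the
  variables \<open>u\<close>, the diagonal coefficients equal 1 and, by hypothesis, every coefficient in which exactly two
  indices occur is at least 1, and every coefficient in which all three indices occur is at least
  \<open>-1\<close>. On the nonnegative orthant the form therefore dominates the form with coefficients exactly
  \<open>1\<close>, \<open>1\<close> and \<open>-1\<close>. With all coefficients 1 the form would be \<open>s ^ 4\<close>, where
  \<open>s = u 1 + u 2 + u 3\<close>; changing the sign of the mixed part \<open>12 * u 1 * u 2 * u 3 * s\<close> gives
  \<open>s * (s ^ 3 - 24 * u 1 * u 2 * u 3)\<close>. This is positive for \<open>s > 0\<close> by the inequality of arithmetic and geometric
  means in the form \<open>s ^ 3 \<ge> 27 * u 1 * u 2 * u 3\<close> (\<open>signed_quartic_form_pos\<close>).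
\<close>

lemma symmetric_tensor4_swap:
  assumes "symmetric_tensor4 T"
  shows "T i j k l = T j i k l" "T i j k l = T i k j l" "T i j k l = T i j l k"
proof -
  let ?s = "\<lambda>m::nat. if m = 1 then i else if m = 2 then j else if m = 3 then k else l"
  have inv: "T (?s (p 1)) (?s (p 2)) (?s (p 3)) (?s (p 4)) = T i j k l" if "p permutes {1..4}" for p
    using assms[unfolded symmetric_tensor4_def, rule_format, OF that, of ?s] by simp
  have perm: "Transposition.transpose m n permutes {1..4}" if "m \<in> {1..4}" "n \<in> {1..4}" for m n :: nat
    using that by (rule permutes_swap_id)
  show "T i j k l = T j i k l"
    using inv[OF perm[of 1 2]] by (simp add: Transposition.transpose_def)
  show "T i j k l = T i k j l"
    using inv[OF perm[of 2 3]] by (simp add: Transposition.transpose_def)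
  show "T i j k l = T i j l k"
    using inv[OF perm[of 3 4]] by (simp add: Transposition.transpose_def)
qed

text \<open>
  The numerical factors are the multinomial coefficients: the number of index quadruples which
  symmetry identifies with the one displayed.
\<close>

lemma tensor4_form_3:
  fixes T :: "3 tensor4"
  assumes "symmetric_tensor4 T"
  shows "tensor4_form T x =
      T 1 1 1 1 * x $ 1 ^ 4 + T 2 2 2 2 * x $ 2 ^ 4 + T 3 3 3 3 * x $ 3 ^ 4
    + 4 * (T 1 1 1 2 * (x $ 1 ^ 3 * x $ 2) + T 1 1 1 3 * (x $ 1 ^ 3 * x $ 3)
         + T 2 2 2 1 * (x $ 2 ^ 3 * x $ 1) + T 2 2 2 3 * (x $ 2 ^ 3 * x $ 3)
         + T 3 3 3 1 * (x $ 3 ^ 3 * x $ 1) + T 3 3 3 2 * (x $ 3 ^ 3 * x $ 2))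
    + 6 * (T 1 1 2 2 * (x $ 1 ^ 2 * x $ 2 ^ 2) + T 1 1 3 3 * (x $ 1 ^ 2 * x $ 3 ^ 2)
         + T 2 2 3 3 * (x $ 2 ^ 2 * x $ 3 ^ 2))
    + 12 * (T 1 1 2 3 * (x $ 1 ^ 2 * x $ 2 * x $ 3) + T 1 2 2 3 * (x $ 1 * x $ 2 ^ 2 * x $ 3)
          + T 1 2 3 3 * (x $ 1 * x $ 2 * x $ 3 ^ 2))"
proof -
  note swap = symmetric_tensor4_swap[OF assms]
  \<comment> \<open>Used as ordered rewrite rules, the swaps bring each index quadruple into a normal form.\<close>
  show ?thesis
    unfolding tensor4_form_def sum_3
    by (simp add: swap) (simp add: algebra_simps eval_nat_numeral)
qed

text \<open>
  The identity \<open>u^3 + v^3 + w^3 - 3uvw = (u + v + w) ((u-v)^2 + (v-w)^2 + (w-u)^2) / 2\<close> bounds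
  \<open>uvw\<close> by the cubes; the rest of \<open>(u + v + w)^3\<close> is handled by \<open>u (v-w)^2 \<ge> 0\<close> and its cyclic
  variants.
\<close>

lemma arith_geo_mean_3:
  fixes u v w :: real
  assumes "0 \<le> u" "0 \<le> v" "0 \<le> w"
  shows "27 * (u * v * w) \<le> (u + v + w) ^ 3"
proof -
  have "0 \<le> (u + v + w) * ((u - v)\<^sup>2 + (v - w)\<^sup>2 + (w - u)\<^sup>2) / 2
           + 3 * (u * (v - w)\<^sup>2 + v * (w - u)\<^sup>2 + w * (u - v)\<^sup>2)"
    using assms by simp
  also have "\<dots> = (u + v + w) ^ 3 - 27 * (u * v * w)"
    by (simp add: field_simps power2_eq_square power3_eq_cube)
  finally show ?thesis by simp
qed

lemma signed_quartic_form_pos: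
  fixes u v w :: real
  assumes "0 \<le> u" "0 \<le> v" "0 \<le> w" "0 < u + v + w"
  shows "0 < u ^ 4 + v ^ 4 + w ^ 4
    + 4 * (u ^ 3 * v + u ^ 3 * w + v ^ 3 * u + v ^ 3 * w + w ^ 3 * u + w ^ 3 * v)
    + 6 * (u ^ 2 * v ^ 2 + u ^ 2 * w ^ 2 + v ^ 2 * w ^ 2)
    - 12 * (u ^ 2 * v * w + u * v ^ 2 * w + u * v * w ^ 2)" (is "0 < ?q")
proof -
  have "0 < (u + v + w) ^ 3 - 24 * (u * v * w)"
    using arith_geo_mean_3[OF assms(1-3)] zero_less_power[OF assms(4), of 3] by linarith
  then have "0 < (u + v + w) * ((u + v + w) ^ 3 - 24 * (u * v * w))"
    using assms(4) by simp
  also have "\<dots> = ?q"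
    by (simp add: algebra_simps eval_nat_numeral)
  finally show ?thesis .
qed

theorem theorem3p10:
  fixes T :: "3 tensor4"
  assumes "symmetric_tensor4 T"
    and "\<And>i. T i i i i > 0"
    and "T 1 1 2 3 \<ge> - (T 1 1 1 1 powr (1/2) * T 2 2 2 2 powr (1/4) * T 3 3 3 3 powr (1/4))"
    and "T 1 2 2 3 \<ge> - (T 1 1 1 1 powr (1/4) * T 2 2 2 2 powr (1/2) * T 3 3 3 3 powr (1/4))"
    and "T 1 2 3 3 \<ge> - (T 1 1 1 1 powr (1/4) * T 2 2 2 2 powr (1/4) * T 3 3 3 3 powr (1/2))"
    and "\<And>i j. i \<noteq> j \<Longrightarrow> T i i j j \<ge> sqrt (T i i i i * T j j j j)"
    and "\<And>i j. i \<noteq> j \<Longrightarrow> T i i i j \<ge> T i i i i powr (3/4) * T j j j j powr (1/4)"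
  shows "strictly_copositive T"
  unfolding strictly_copositive_def
proof (intro allI impI, elim conjE)
  fix x :: "real ^ 3"
  assume nonneg: "\<forall>i. 0 \<le> x $ i" and nonzero: "x \<noteq> 0"
  define a where "a i = T i i i i powr (1/4)" for i
  define u where "u i = a i * x $ i" for i
  have a_pos: "0 < a i" for i
    using assms(2)[of i] by (simp add: a_def)
  have powr_a: "T i i i i powr (real n / 4) = a i ^ n" for i n
    using assms(2)[of i] by (simp add: a_def powr_powr flip: powr_realpow)
  have diag: "T i i i i = a i ^ 4" for i
    using powr_a[of i 4] assms(2)[of i] by simp
  have half: "T i i i i powr (1/2) = a i ^ 2" for i
    using powr_a[of i 2] by simp
  have three_quarters: "T i i i i powr (3/4) = a i ^ 3" for i
    using powr_a[of i 3] by simp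
  have sqrt_diag: "sqrt (T i i i i * T j j j j) = a i ^ 2 * a j ^ 2" for i j
  proof (rule real_sqrt_unique)
    show "(a i ^ 2 * a j ^ 2)\<^sup>2 = T i i i i * T j j j j"
      by (simp add: diag power_mult_distrib flip: power_mult)
  qed simp
  have u_nonneg: "0 \<le> u i" for i
    using nonneg a_pos[of i] by (simp add: u_def)
  obtain i where "x $ i \<noteq> 0"
    using nonzero by (auto simp: vec_eq_iff)
  then have "0 < u i"
    using nonneg a_pos[of i] by (simp add: u_def less_le)
  then have "0 < (\<Sum>i\<in>UNIV. u i)"
    using u_nonneg by (intro sum_pos2[of UNIV i]) auto
  then have u_sum: "0 < u 1 + u 2 + u 3"
    by (simp only: sum_3)

  have iiii: "T i i i i * x $ i ^ 4 = u i ^ 4" for i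
    by (simp add: diag u_def power_mult_distrib)
  have iiij: "u i ^ 3 * u j \<le> T i i i j * (x $ i ^ 3 * x $ j)" if "i \<noteq> j" for i j
  proof -
    have "a i ^ 3 * a j \<le> T i i i j"
      using assms(7)[OF that] by (simp add: three_quarters flip: a_def)
    from mult_right_mono[OF this, of "x $ i ^ 3 * x $ j"] show ?thesis
      using nonneg by (simp add: u_def power_mult_distrib ac_simps)
  qed
  have iijj: "u i ^ 2 * u j ^ 2 \<le> T i i j j * (x $ i ^ 2 * x $ j ^ 2)" if "i \<noteq> j" for i j
  proof -
    have "a i ^ 2 * a j ^ 2 \<le> T i i j j"
      using assms(6)[OF that] by (simp add: sqrt_diag)
    from mult_right_mono[OF this, of "x $ i ^ 2 * x $ j ^ 2"] show ?thesis
      using nonneg by (simp add: u_def power_mult_distrib ac_simps)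
  qed
  have mixed:
    "- (u 1 ^ 2 * u 2 * u 3) \<le> T 1 1 2 3 * (x $ 1 ^ 2 * x $ 2 * x $ 3)"
    "- (u 1 * u 2 ^ 2 * u 3) \<le> T 1 2 2 3 * (x $ 1 * x $ 2 ^ 2 * x $ 3)"
    "- (u 1 * u 2 * u 3 ^ 2) \<le> T 1 2 3 3 * (x $ 1 * x $ 2 * x $ 3 ^ 2)"
    using mult_right_mono[OF assms(3)[unfolded half, folded a_def], of "x $ 1 ^ 2 * x $ 2 * x $ 3"]
      mult_right_mono[OF assms(4)[unfolded half, folded a_def], of "x $ 1 * x $ 2 ^ 2 * x $ 3"]
      mult_right_mono[OF assms(5)[unfolded half, folded a_def], of "x $ 1 * x $ 2 * x $ 3 ^ 2"]
      nonneg
    by (simp_all add: u_def power_mult_distrib ac_simps)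

  have "0 < u 1 ^ 4 + u 2 ^ 4 + u 3 ^ 4
    + 4 * (u 1 ^ 3 * u 2 + u 1 ^ 3 * u 3 + u 2 ^ 3 * u 1 + u 2 ^ 3 * u 3 + u 3 ^ 3 * u 1 + u 3 ^ 3 * u 2)
    + 6 * (u 1 ^ 2 * u 2 ^ 2 + u 1 ^ 2 * u 3 ^ 2 + u 2 ^ 2 * u 3 ^ 2)
    - 12 * (u 1 ^ 2 * u 2 * u 3 + u 1 * u 2 ^ 2 * u 3 + u 1 * u 2 * u 3 ^ 2)"
    using signed_quartic_form_pos[OF u_nonneg u_nonneg u_nonneg u_sum] .
  also have "\<dots> \<le> tensor4_form T x"
    unfolding tensor4_form_3[OF assms(1)] iiii
    using iiij[of 1 2] iiij[of 1 3] iiij[of 2 1] iiij[of 2 3] iiij[of 3 1] iiij[of 3 2]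
      iijj[of 1 2] iijj[of 1 3] iijj[of 2 3] mixed
    by simp
  finally show "0 < tensor4_form T x" .
qed

end
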